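(* Let $[ES]$ stand for either one of the two encodings $[ES2]$ or $[ES1]$ of flat braids on $3$ strands. The list of alternating sums of rows of $[ES]$ is a complete invariant of flat braids on $3$ strands: two flat braids on $3$ strands, of lengths $k$ and $k'$, are equal as group elements (represent the same permutation) if and only if the columns $[ES][\pm]_{k\times 1}$ and $[ES][\pm]_{k'\times 1}$ computed from their respective encodings are equal.
   Context: A flat braid on $3$ strands of length $k\ge 0$ means a word $s_{i_1}\cdots s_{i_k}$, $i_t\in\{1,2\}$, where $s_1=(1\;2)$ and $s_2=(2\;3)$ are the adjacent transpositions in the symmetric group $\mathfrak{S}_3$ (equivalently, the braid-like diagram without over/under information it describes). Two flat braids are equal as group elements if they express the same permutation in $\mathfrak{S}_3$. Strands are labelled $1,2,3$ by their positions (top to bottom) at the left end. Put $a_0=(1,2,3)$ and let $a_t$ be obtained from $a_{t-1}$ by swapping the entries in positions $i_t$ and $i_t+1$. The $t$-th crossing involves the two strands $a_{t-1}(i_t)$ and $a_{t-1}(i_t+1)$. Encoding $[ES2]$ of a flat braid: the $3\times k$ matrix whose $t$-th column has entry $1$ in the two rows indexed by the strands involved in the $t$-th crossing and $0$ in the remaining row. Encoding $[ES1]$ of a flat braid: the $3\times k$ matrix whose rows $1,2,3$ correspond to the pairs of strands $\{1,2\}$, $\{2,3\}$, $\{3,1\}$ respectively; the $t$-th column has a single non-zero entry, equal to $1$, in the row of the pair of strands crossing at the $t$-th crossing. $[\pm]_{k\times 1}$ is the column whose $t$-th entry is $(-1)^{t+1}$, so $M[\pm]_{k\times 1}$ is the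 column of alternating sums of rows of $M$ (zero if $k=0$). *)

theory Defs
  imports
    "HOL-Algebra.Sym_Groups"
    "Jordan_Normal_Form.Matrix"
begin

(* A flat braid on 3 strands is the word of indices i_1 ... i_k, each 1 or 2. *)
definition flat_braids :: "nat \<Rightarrow> nat list set" where
  "flat_braids k = {w. length w = k \<and> set w \<subseteq> {1, 2}}"

(* The product s_(i_1) ... s_(i_k) in the symmetric group on {1, 2, 3}, whose
   multiplication is composition of functions. *)
definition flat_braid_perm :: "nat list \<Rightarrow> nat \<Rightarrow> nat" where
  "flat_braid_perm w =
     foldr (\<lambda>i p. transpose i (i + 1) \<otimes>\<^bsub>sym_group 3\<^esub> p) w \<one>\<^bsub>sym_group 3\<^esub>"

(* strand_at w t p is the strand in position p after the first t crossings, that is,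
   the entry a_t(p). List indices start at 0, so w ! t is the index of crossing t + 1. *)
primrec strand_at :: "nat list \<Rightarrow> nat \<Rightarrow> nat \<Rightarrow> nat" where
  "strand_at w 0 = (\<lambda>p. p)"
| "strand_at w (Suc t) =
     (strand_at w t)(w ! t := strand_at w t (w ! t + 1), w ! t + 1 := strand_at w t (w ! t))"

definition crossing_strands :: "nat list \<Rightarrow> nat \<Rightarrow> nat set" where
  "crossing_strands w t = {strand_at w t (w ! t), strand_at w t (w ! t + 1)}"

(* Matrix rows and columns are numbered from 0 in the library: row r is the row of strand r + 1
   in ES2 and of the (r + 1)-th pair in ES1. *)
definition ES2 :: "nat list \<Rightarrow> int mat" where
  "ES2 w = mat 3 (length w) (\<lambda>(r, t). if r + 1 \<in> crossing_strands w t then 1 else 0)"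

definition ES1 :: "nat list \<Rightarrow> int mat" where
  "ES1 w = mat 3 (length w)
     (\<lambda>(r, t). if crossing_strands w t = [{1, 2}, {2, 3}, {3, 1}] ! r then 1 else 0)"

(* Entry t here is the entry numbered t + 1 in 1-based numbering, whence (-1)^((t + 1) + 1). *)
definition pm_col :: "nat \<Rightarrow> int mat" where
  "pm_col k = mat k 1 (\<lambda>(t, _). (- 1) ^ (t + 2))"

end

theory Submission
  imports Defs
begin

text \<open>
  The product of the transpositions of a word is the function sending a position to the strand
  that ends there, so equality of permutations is equality of final arrangements
  (\<open>flat_braid_perm_eq_strand_at\<close>), and an
  arrangement of three strands is known as soon as it is known, for each pair of strands, which
  of the two lies above the other. The point is that the alternating sums record exactly this.

  After an even number of crossings the arrangement is a rotation of \<open>(1, 2, 3)\<close>, after an odd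
  number a rotation of \<open>(2, 1, 3)\<close>. Let \<open>(a, b)\<close> be one of the cyclic pairs \<open>(1, 2)\<close>, \<open>(2, 3)\<close>,
  \<open>(3, 1)\<close>. If these two strands are adjacent with \<open>a\<close> above \<open>b\<close>, then the arrangement is a
  rotation of \<open>(1, 2, 3)\<close>, whichever end the third strand is at; if \<open>b\<close> is above \<open>a\<close>, it is a
  rotation of \<open>(2, 1, 3)\<close>. Hence a crossing of the pair has sign \<open>+1\<close> exactly when it brings \<open>b\<close>
  above \<open>a\<close>, and sign \<open>-1\<close> when it undoes this. The alternating sum over the crossings
  of the pair therefore telescopes to the change in the indicator of \<open>b\<close> being above \<open>a\<close>
  (\<open>signed_crossings_eq\<close>).

  For ES1 these are the row sums themselves. For ES2 the row sum of a strand is the sum of the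
  ES1 row sums of the two pairs containing it, and the three sums of two out of three integers
  determine the integers. So both encodings carry the same information.
\<close>

section \<open>The permutation as the final arrangement\<close>

lemma foldr_comp_right:
  "foldr (\<lambda>i q. f i \<circ> q) xs p = foldr (\<lambda>i q. f i \<circ> q) xs id \<circ> p"
  by (induction xs) (auto simp: fun_eq_iff)

lemma strand_at_Suc_comp:
  "strand_at w (Suc t) = strand_at w t \<circ> transpose (w ! t) (w ! t + 1)"
  by (auto simp: fun_eq_iff transpose_def)

lemma strand_at_eq_foldr:
  "t \<le> length w \<Longrightarrow>
     strand_at w t = foldr (\<lambda>i p. transpose i (i + 1) \<circ> p) (take t w) id"
proof (induction t)
  case 0
  then show ?case by (simp add: fun_eq_iff)
next
  case (Suc t)
  have "foldr (\<lambda>i p. transpose i (i + 1) \<circ> p) (take (Suc t) w) id =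
        foldr (\<lambda>i p. transpose i (i + 1) \<circ> p) (take t w) (transpose (w ! t) (w ! t + 1))"
    using Suc.prems by (simp add: take_Suc_conv_app_nth)
  also have "\<dots> = strand_at w t \<circ> transpose (w ! t) (w ! t + 1)"
    using Suc.IH Suc.prems foldr_comp_right[of "\<lambda>i. transpose i (i + 1)"] by (metis Suc_leD)
  finally show ?case
    by (simp only: strand_at_Suc_comp)
qed

lemma flat_braid_perm_eq_strand_at: "flat_braid_perm w = strand_at w (length w)"
  by (simp add: strand_at_eq_foldr flat_braid_perm_def sym_group_def)

lemma strand_at_outside:
  assumes "set w \<subseteq> {1, 2}" "t \<le> length w" "p \<notin> {1, 2, 3}"
  shows "strand_at w t p = p"
  using assms(2)
proof (induction t)
  case (Suc t)
  then have "w ! t \<in> {1, 2}"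
    using nth_mem[of t w] subsetD[OF assms(1)] by simp
  with Suc assms(3) show ?case by auto
qed simp

section \<open>Signed crossings of a pair of strands\<close>

lemma crossing_cases:
  assumes "set w \<subseteq> {1, 2}" "t < length w"
  obtains (top)
      "strand_at w (Suc t) 1 = strand_at w t 2" "strand_at w (Suc t) 2 = strand_at w t 1"
      "strand_at w (Suc t) 3 = strand_at w t 3"
      "crossing_strands w t = {strand_at w t 1, strand_at w t 2}"
    | (bottom)
      "strand_at w (Suc t) 1 = strand_at w t 1" "strand_at w (Suc t) 2 = strand_at w t 3"
      "strand_at w (Suc t) 3 = strand_at w t 2"
      "crossing_strands w t = {strand_at w t 2, strand_at w t 3}"
proof -
  have "w ! t = 1 \<or> w ! t = 2"
    using nth_mem[of t w] subsetD[OF assms(1)] assms(2) by simp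
  then show thesis
  proof
    assume "w ! t = 1"
    then show thesis
      by (intro top; simp add: crossing_strands_def numeral_2_eq_2 numeral_3_eq_3)
  next
    assume "w ! t = 2"
    then show thesis
      by (intro bottom; simp add: crossing_strands_def numeral_2_eq_2 numeral_3_eq_3)
  qed
qed

text \<open>
  Each crossing is a transposition, so the even permutations, which are the rotations, alternate
  with the odd ones. This is what makes the sign of a crossing depend on the arrangement alone.
\<close>

lemma strand_at_parity:
  assumes "set w \<subseteq> {1, 2}" "t \<le> length w"
  shows "(strand_at w t 1, strand_at w t 2, strand_at w t 3) \<in>
    (if even t then {(1, 2, 3), (2, 3, 1), (3, 1, 2)} else {(2, 1, 3), (1, 3, 2), (3, 2, 1)})"
  using assms(2)
proof (induction t)
  case 0
  then show ?case by simp
next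
  case (Suc t)
  then have t: "t < length w" and
    IH: "(strand_at w t 1, strand_at w t 2, strand_at w t 3) \<in>
      (if even t then {(1, 2, 3), (2, 3, 1), (3, 1, 2)} else {(2, 1, 3), (1, 3, 2), (3, 2, 1)})"
    by simp_all
  from assms(1) t show ?case
  proof (cases rule: crossing_cases)
    case top
    with IH show ?thesis
      unfolding top even_Suc by (cases "even t") (simp_all del: strand_at.simps, safe)
  next
    case bottom
    with IH show ?thesis
      unfolding bottom even_Suc by (cases "even t") (simp_all del: strand_at.simps, safe)
  qed
qed

lemma strand_at_permutes:
  assumes "set w \<subseteq> {1, 2}" "t \<le> length w"
  shows "(strand_at w t 1, strand_at w t 2, strand_at w t 3) \<in>
    {(1, 2, 3), (2, 3, 1), (3, 1, 2), (2, 1, 3), (1, 3, 2), (3, 2, 1)}"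
  using strand_at_parity[OF assms] by (cases "even t"; simp only: if_True if_False; blast)

lemma crossing_strands_pair:
  assumes "set w \<subseteq> {1, 2}" "t < length w"
  shows "crossing_strands w t \<in> {{1, 2}, {2, 3}, {3, 1}}"
proof -
  have "(strand_at w t 1, strand_at w t 2, strand_at w t 3) \<in>
      {(1, 2, 3), (2, 3, 1), (3, 1, 2), (2, 1, 3), (1, 3, 2), (3, 2, 1)}"
    using assms by (intro strand_at_permutes) simp_all
  then have "{strand_at w t 1, strand_at w t 2} \<in> {{1, 2}, {2, 3}, {3, 1}} \<and>
      {strand_at w t 2, strand_at w t 3} \<in> {{1, 2}, {2, 3}, {3, 1}}"
    by (elim insertE emptyE; simp only: prod.inject; simp add: insert_commute)
  with assms show ?thesis
    by (cases rule: crossing_cases) simp_all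
qed

definition lies_above :: "(nat \<Rightarrow> nat) \<Rightarrow> nat \<Rightarrow> nat \<Rightarrow> bool" where
  "lies_above \<sigma> a b \<longleftrightarrow> \<sigma> 1 = a \<and> \<sigma> 2 = b \<or> \<sigma> 1 = a \<and> \<sigma> 3 = b \<or> \<sigma> 2 = a \<and> \<sigma> 3 = b"

definition signed_crossings :: "nat list \<Rightarrow> nat \<Rightarrow> nat \<Rightarrow> int" where
  "signed_crossings w a b =
     (\<Sum>t<length w. of_bool (crossing_strands w t = {a, b}) * (- 1) ^ t)"

text \<open>
  Both arrangements in which strands \<open>a\<close> and \<open>b\<close> are adjacent in this order are rotations of each
  other, so the sign of their crossing depends only on which of them is above.
\<close>

lemma crossing_sign:
  assumes "set w \<subseteq> {1, 2}" "t < length w" "(a, b) \<in> {(1, 2), (2, 3), (3, 1)}"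
  shows "of_bool (crossing_strands w t = {a, b}) * (- 1) ^ t =
    (of_bool (lies_above (strand_at w (Suc t)) b a) - of_bool (lies_above (strand_at w t) b a) :: int)"
proof -
  define x y z where xyz: "x = strand_at w t 1" "y = strand_at w t 2" "z = strand_at w t 3"
  have parity: "(x, y, z) \<in>
      (if even t then {(1, 2, 3), (2, 3, 1), (3, 1, 2)} else {(2, 1, 3), (1, 3, 2), (3, 2, 1)})"
    unfolding xyz using assms(1,2) by (intro strand_at_parity) simp_all
  from assms(1,2) show ?thesis
  proof (cases rule: crossing_cases)
    case top
    from parity assms(3) show ?thesis
      unfolding lies_above_def top xyz[symmetric] doubleton_eq_iff
      by (cases "even t"; simp only: if_True if_False; elim insertE emptyE;
          simp only: prod.inject; simp)
  next
    case bottom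
    from parity assms(3) show ?thesis
      unfolding lies_above_def bottom xyz[symmetric] doubleton_eq_iff
      by (cases "even t"; simp only: if_True if_False; elim insertE emptyE;
          simp only: prod.inject; simp)
  qed
qed

text \<open>Telescoping of \<open>crossing_sign\<close>. The subtracted term is \<open>1\<close> only for the pair
  \<open>(3, 1)\<close>, which starts with \<open>b\<close> above.\<close>

lemma signed_crossings_eq:
  assumes "set w \<subseteq> {1, 2}" "(a, b) \<in> {(1, 2), (2, 3), (3, 1)}"
  shows "signed_crossings w a b =
    of_bool (lies_above (strand_at w (length w)) b a) - of_bool (lies_above id b a)"
proof -
  have "signed_crossings w a b = (\<Sum>t<length w.
      of_bool (lies_above (strand_at w (Suc t)) b a) - of_bool (lies_above (strand_at w t) b a))"
    unfolding signed_crossings_def by (intro sum.cong refl crossing_sign assms) simp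
  also have "\<dots> = of_bool (lies_above (strand_at w (length w)) b a) - of_bool (lies_above id b a)"
    by (subst sum_lessThan_telescope) (simp add: id_def)
  finally show ?thesis .
qed

text \<open>
  The relative order of each pair determines the arrangement of the three strands, and all other
  positions are fixed.
\<close>

lemma flat_braid_perm_eq_iff_signed_crossings:
  assumes "set w \<subseteq> {1, 2}" "set w' \<subseteq> {1, 2}"
  shows "flat_braid_perm w = flat_braid_perm w' \<longleftrightarrow>
    (\<forall>(a, b) \<in> {(1, 2), (2, 3), (3, 1)}. signed_crossings w a b = signed_crossings w' a b)"
proof -
  define \<sigma> where "\<sigma> = strand_at w (length w)"
  define \<sigma>' where "\<sigma>' = strand_at w' (length w')"
  have "\<sigma> p = \<sigma>' p" if "p \<notin> {1, 2, 3}" for p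
    using that assms strand_at_outside[of _ _ p] by (simp add: \<sigma>_def \<sigma>'_def)
  then have "\<sigma> = \<sigma>' \<longleftrightarrow> (\<sigma> 1, \<sigma> 2, \<sigma> 3) = (\<sigma>' 1, \<sigma>' 2, \<sigma>' 3)"
    unfolding fun_eq_iff by (metis Pair_inject insert_iff empty_iff)
  also have "\<dots> \<longleftrightarrow> (\<forall>(a, b) \<in> {(1, 2), (2, 3), (3, 1)}. lies_above \<sigma> b a = lies_above \<sigma>' b a)"
  proof -
    have perms: "(\<sigma> 1, \<sigma> 2, \<sigma> 3) \<in>
        {(1, 2, 3), (2, 3, 1), (3, 1, 2), (2, 1, 3), (1, 3, 2), (3, 2, 1)}"
      "(\<sigma>' 1, \<sigma>' 2, \<sigma>' 3) \<in>
        {(1, 2, 3), (2, 3, 1), (3, 1, 2), (2, 1, 3), (1, 3, 2), (3, 2, 1)}"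
      unfolding \<sigma>_def \<sigma>'_def by (intro strand_at_permutes assms order_refl)+
    then show ?thesis
      by (elim insertE emptyE; simp add: lies_above_def)
  qed
  also have "\<dots> \<longleftrightarrow>
      (\<forall>(a, b) \<in> {(1, 2), (2, 3), (3, 1)}. signed_crossings w a b = signed_crossings w' a b)"
  proof -
    have "lies_above \<sigma> b a = lies_above \<sigma>' b a \<longleftrightarrow>
        signed_crossings w a b = signed_crossings w' a b"
      if "(a, b) \<in> {(1, 2), (2, 3), (3, 1)}" for a b
      using signed_crossings_eq[OF assms(1) that] signed_crossings_eq[OF assms(2) that]
      by (simp add: \<sigma>_def \<sigma>'_def of_bool_eq_iff)
    then show ?thesis by blast
  qed
  finally show ?thesis
    by (simp add: flat_braid_perm_eq_strand_at \<sigma>_def \<sigma>'_def)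
qed

section \<open>The alternating row sums of the two encodings\<close>

lemma row_alternating_sum:
  assumes "r < 3"
  shows "(mat 3 k f * pm_col k) $$ (r, 0) = (\<Sum>t<k. f (r, t) * (- 1) ^ t)"
  using assms by (simp add: pm_col_def scalar_prod_def lessThan_atLeast0)

lemma ES1_alternating_sums:
  "(ES1 w * pm_col (length w)) $$ (0, 0) = signed_crossings w 1 2"
  "(ES1 w * pm_col (length w)) $$ (1, 0) = signed_crossings w 2 3"
  "(ES1 w * pm_col (length w)) $$ (2, 0) = signed_crossings w 3 1"
  by (simp_all add: ES1_def row_alternating_sum signed_crossings_def of_bool_def
      del: index_mult_mat)

text \<open>
  Of the three pairs, exactly two contain a given strand, so the incidence of the strand with a
  crossing is the sum of two indicators of pairs.
\<close>

lemma ES2_alternating_sums: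
  assumes "set w \<subseteq> {1, 2}"
  shows "(ES2 w * pm_col (length w)) $$ (0, 0) = signed_crossings w 1 2 + signed_crossings w 3 1"
    and "(ES2 w * pm_col (length w)) $$ (1, 0) = signed_crossings w 1 2 + signed_crossings w 2 3"
    and "(ES2 w * pm_col (length w)) $$ (2, 0) = signed_crossings w 2 3 + signed_crossings w 3 1"
proof -
  have sum_of_pairs: "(ES2 w * pm_col (length w)) $$ (r, 0) =
      signed_crossings w a b + signed_crossings w c d"
    if "r < 3" and incidence: "\<And>t. t < length w \<Longrightarrow> of_bool (r + 1 \<in> crossing_strands w t) =
      (of_bool (crossing_strands w t = {a, b}) + of_bool (crossing_strands w t = {c, d}) :: int)"
    for r a b c d
  proof -
    have "(ES2 w * pm_col (length w)) $$ (r, 0) =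
        (\<Sum>t<length w. of_bool (r + 1 \<in> crossing_strands w t) * (- 1) ^ t)"
      unfolding ES2_def row_alternating_sum[OF that(1)] by (simp add: of_bool_def)
    also have "\<dots> = signed_crossings w a b + signed_crossings w c d"
      unfolding signed_crossings_def sum.distrib[symmetric] distrib_right[symmetric]
      by (intro sum.cong refl arg_cong2[where f = "(*)"] incidence) simp
    finally show ?thesis .
  qed
  note pair = crossing_strands_pair[OF assms]
  show "(ES2 w * pm_col (length w)) $$ (0, 0) = signed_crossings w 1 2 + signed_crossings w 3 1"
    by (rule sum_of_pairs, simp, drule pair, elim insertE emptyE; simp add: doubleton_eq_iff)
  show "(ES2 w * pm_col (length w)) $$ (1, 0) = signed_crossings w 1 2 + signed_crossings w 2 3"
    by (rule sum_of_pairs, simp, drule pair, elim insertE emptyE; simp add: doubleton_eq_iff)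
  show "(ES2 w * pm_col (length w)) $$ (2, 0) = signed_crossings w 2 3 + signed_crossings w 3 1"
    by (rule sum_of_pairs, simp, drule pair, elim insertE emptyE; simp add: doubleton_eq_iff)
qed

lemma alternating_sums_eq_iff:
  assumes "dim_row (E w) = 3" "dim_row (E w') = 3"
  shows "E w * pm_col k = E w' * pm_col k' \<longleftrightarrow>
    (\<forall>r \<in> {0, 1, 2}. (E w * pm_col k) $$ (r, 0) = (E w' * pm_col k') $$ (r, 0))"
    (is "?L \<longleftrightarrow> ?R")
proof
  assume ?R
  show ?L
  proof (rule eq_matI)
    fix i j assume "i < dim_row (E w' * pm_col k')" "j < dim_col (E w' * pm_col k')"
    then have "i \<in> {0, 1, 2}" "j = 0"
      using assms by (auto simp: pm_col_def)
    with \<open>?R\<close> show "(E w * pm_col k) $$ (i, j) = (E w' * pm_col k') $$ (i, j)"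
      by blast
  qed (use assms in \<open>simp_all add: pm_col_def\<close>)
qed simp

theorem mainTheorem4:
  fixes ES :: "nat list \<Rightarrow> int mat" and w w' :: "nat list" and k k' :: nat
  assumes "ES \<in> {ES2, ES1}"
    and "w \<in> flat_braids k" and "w' \<in> flat_braids k'"
  shows "flat_braid_perm w = flat_braid_perm w' \<longleftrightarrow> ES w * pm_col k = ES w' * pm_col k'"
proof -
  have w: "set w \<subseteq> {1, 2}" "set w' \<subseteq> {1, 2}" and k: "k = length w" "k' = length w'"
    using assms(2,3) by (auto simp: flat_braids_def)
  have "dim_row (ES w) = 3" "dim_row (ES w') = 3"
    using assms(1) by (auto simp: ES1_def ES2_def)
  note entries = alternating_sums_eq_iff[of ES, OF this, of k k']
  note perm = flat_braid_perm_eq_iff_signed_crossings[OF w]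
  from assms(1) consider "ES = ES2" | "ES = ES1" by blast
  then show ?thesis
  proof cases
    case 1
    show ?thesis
      unfolding entries perm unfolding 1 k ball_simps ES2_alternating_sums[OF w(1)]
        ES2_alternating_sums[OF w(2)]
      by auto
  next
    case 2
    show ?thesis
      unfolding entries perm unfolding 2 k ball_simps ES1_alternating_sums by auto
  qed
qed

end
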